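(* Let $\Delta t>0$ and let $n\ge 1$. Let $\phi^{n},\phi^{n-1},\tilde\phi^{n+\frac12}$ be given functions on $\Omega$ and $r^n,r^{n-1}\in\mathbb{R}$ be given, and suppose that functions $\phi^{n+1},\mu^{n+1}$ on $\Omega$ and $r^{n+1}\in\mathbb{R}$ satisfy the second order semi-implicit SAV/BDF scheme $$\frac{3\phi^{n+1}-4\phi^{n}+\phi^{n-1}}{2\Delta t}=-M\mathcal{L}\mu^{n+1},$$ $$\mu^{n+1}=\epsilon^2\mathcal{L}\phi^{n+1}+\frac{r^{n+1}}{\sqrt{E_1(\tilde{\phi}^{n+\frac{1}{2}})+C_0}}F'(\tilde{\phi}^{n+\frac{1}{2}}),$$ $$\frac{3r^{n+1}-4r^{n}+r^{n-1}}{2\Delta t}=\int_{\Omega}\frac{F'(\tilde{\phi}^{n+\frac{1}{2}})}{2\sqrt{E_1(\tilde{\phi}^{n+\frac{1}{2}})+C_0}}\,\frac{3\phi^{n+1}-4\phi^{n}+\phi^{n-1}}{2\Delta t}\,d\mathbf{x}.$$ Then the scheme is unconditionally energy stable (no restriction on $\Delta t$), in the sense that $$\begin{aligned} &\frac{\epsilon^2}{2}(\mathcal{L}\phi^{n+1},\phi^{n+1})+\frac{\epsilon^2}{2}(\mathcal{L}(2\phi^{n+1}-\phi^n),2\phi^{n+1}-\phi^n)+|r^{n+1}|^2+|2r^{n+1}-r^n|^2\\ &\leq\frac{\epsilon^2}{2}(\mathcal{L}\phi^{n},\phi^{n})+\frac{\epsilon^2}{2}(\mathcal{L}(2\phi^{n}-\phi^{n-1}),2\phi^{n}-\phi^{n-1})+|r^{n}|^2+|2r^{n}-r^{n-1}|^2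 . \end{aligned}$$
   Context: $\Omega\subseteq\mathbb{R}^d$ is a bounded domain, $M>0$ is the mobility constant, $\epsilon>0$ is a constant, and $F$ is a continuously differentiable nonlinear potential with derivative $F'$. The kernel $J$ satisfies: $J(\mathbf{x})\ge 0$; $J(\mathbf{x}-\mathbf{y})=J(\mathbf{y}-\mathbf{x})$; and $J$ is $\Omega$-periodic. The nonlocal diffusion operator is $$\mathcal{L}u(\mathbf{x})=\int_{\Omega}J(\mathbf{x}-\mathbf{y})[u(\mathbf{x})-u(\mathbf{y})]\,d\mathbf{y},\qquad \mathbf{x}\in\Omega.$$ The inner product is $(u,v)=\int_\Omega uv\,d\mathbf{x}$. Set $E_1(\phi)=\int_\Omega F(\phi)\,d\mathbf{x}$, which is assumed bounded below, $E_1(\phi)\ge -C_0$ for a constant $C_0$; it is understood that $E_1(\tilde\phi^{n+\frac12})+C_0>0$ so the scheme makes sense. The function $\tilde\phi^{n+\frac12}$ is any explicit (i.e. computed from previous time levels) $O(\Delta t^2)$ approximation of $\phi(t^{n+1})$, where $\phi(t)$ is the exact solution of $\phi_t=-M\mathcal{L}\mu$, $\mu=F'(\phi)+\epsilon^2\mathcal{L}\phi$, and $t^{n}=n\Delta t$. All functions and the kernel are assumed regular enough that all the integrals and inner products converge and the order of integration may be exchanged. *)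

theory Defs
  imports "HOL-Analysis.Analysis"
begin

definition bounded_domain :: "(real ^ 'd) set \<Rightarrow> bool" where
  "bounded_domain \<Omega> \<longleftrightarrow> open \<Omega> \<and> connected \<Omega> \<and> \<Omega> \<noteq> {} \<and> bounded \<Omega>"

definition lattice_of :: "(real ^ 'd) set \<Rightarrow> (real ^ 'd) set" where
  "lattice_of B = {\<Sum>b\<in>B. of_int (k b) *\<^sub>R b | k :: real ^ 'd \<Rightarrow> int. True}"

(* Omega is a period cell: its lattice translates are pairwise disjoint and fill the
   space up to a null set.  For the box with sides l_i one takes B = {l_i e_i}. *)
definition period_cell :: "(real ^ 'd) set \<Rightarrow> (real ^ 'd) set \<Rightarrow> bool" where
  "period_cell B \<Omega> \<longleftrightarrow>
     (\<forall>p\<in>lattice_of B. p \<noteq> 0 \<longrightarrow> \<Omega> \<inter> (+) p ` \<Omega> = {}) \<and>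
     negligible (UNIV - (\<Union>p\<in>lattice_of B. (+) p ` \<Omega>))"

definition domain_periodic :: "(real ^ 'd) set \<Rightarrow> (real ^ 'd \<Rightarrow> real) \<Rightarrow> bool" where
  "domain_periodic \<Omega> J \<longleftrightarrow>
     (\<exists>B. independent B \<and> span B = UNIV \<and> period_cell B \<Omega> \<and>
          (\<forall>p\<in>lattice_of B. \<forall>x. J (x + p) = J x))"

definition nonlocal_op ::
  "(real ^ 'd) set \<Rightarrow> (real ^ 'd \<Rightarrow> real) \<Rightarrow> (real ^ 'd \<Rightarrow> real) \<Rightarrow> real ^ 'd \<Rightarrow> real" where
  "nonlocal_op \<Omega> J u x = (LINT y:\<Omega>|lebesgue. J (x - y) * (u x - u y))"

definition L2_ip ::
  "(real ^ 'd) set \<Rightarrow> (real ^ 'd \<Rightarrow> real) \<Rightarrow> (real ^ 'd \<Rightarrow> real) \<Rightarrow> real" where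
  "L2_ip \<Omega> u v = (LINT x:\<Omega>|lebesgue. u x * v x)"

definition E1 ::
  "(real ^ 'd) set \<Rightarrow> (real \<Rightarrow> real) \<Rightarrow> (real ^ 'd \<Rightarrow> real) \<Rightarrow> real" where
  "E1 \<Omega> F u = (LINT x:\<Omega>|lebesgue. F (u x))"

definition nonlocal_converges ::
  "(real ^ 'd) set \<Rightarrow> (real ^ 'd \<Rightarrow> real) \<Rightarrow> (real ^ 'd \<Rightarrow> real) \<Rightarrow> bool" where
  "nonlocal_converges \<Omega> J u \<longleftrightarrow>
     (\<forall>x\<in>\<Omega>. set_integrable lebesgue \<Omega> (\<lambda>y. J (x - y) * (u x - u y)))"

(* Absolute convergence of the double integral behind the inner product of
   (nonlocal_op u) with v; by Fubini the order of integration may then be exchanged. *)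
definition nonlocal_form_integrable ::
  "(real ^ 'd) set \<Rightarrow> (real ^ 'd \<Rightarrow> real) \<Rightarrow> (real ^ 'd \<Rightarrow> real) \<Rightarrow> (real ^ 'd \<Rightarrow> real) \<Rightarrow> bool" where
  "nonlocal_form_integrable \<Omega> J u v \<longleftrightarrow>
     set_integrable lebesgue (\<Omega> \<times> \<Omega>) (\<lambda>(x, y). J (x - y) * (u x - u y) * v x)"

end

theory Submission
  imports Defs
begin

text \<open>
  Averaging over \<open>(x, y) \<mapsto> (y, x)\<close> gives
  \<open>2 (\<L>u, v) = \<integral>\<integral> J(x - y) (u x - u y) (v x - v y)\<close>, so \<open>\<L>\<close> is symmetric and nonnegative.
  With \<open>w = 3 \<phi>\<^sup>n\<^sup>+\<^sup>1 - 4 \<phi>\<^sup>n + \<phi>\<^sup>n\<^sup>-\<^sup>1\<close>, the first equation and \<open>(\<L>\<mu>, \<mu>) \<ge> 0\<close> give \<open>(w, \<mu>) \<le> 0\<close>. The other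
  two equations turn this into
  \<open>\<epsilon>\<^sup>2 (\<L>\<phi>\<^sup>n\<^sup>+\<^sup>1, w) + 2 r\<^sup>n\<^sup>+\<^sup>1 (3 r\<^sup>n\<^sup>+\<^sup>1 - 4 r\<^sup>n + r\<^sup>n\<^sup>-\<^sup>1) \<le> 0\<close>, and the BDF2 identity rewrites both terms
  as differences of energies plus the square of a second difference.
\<close>

section \<open>Fubini and coordinate exchange for the completed Lebesgue measure\<close>

text \<open>The preimages of a set under \<open>f\<close> and \<open>g\<close> differ only inside a
  null set, and completeness makes every subset of a null set measurable.\<close>

lemma (in complete_measure) measurable_AE_cong:
  assumes ae: "AE x in M. f x = g x" and g: "g \<in> M \<rightarrow>\<^sub>M N" and sp: "f \<in> space M \<rightarrow> space N"
  shows "f \<in> M \<rightarrow>\<^sub>M N"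
proof (rule measurableI)
  fix A assume A: "A \<in> sets N"
  show "f -` A \<inter> space M \<in> sets M"
    by (rule in_sets_AE[of "g -` A \<inter> space M"])
       (use ae measurable_sets[OF g A] in \<open>auto elim!: eventually_mono\<close>)
qed (use sp in auto)

lemma borel_measurable_lebesgue_AE_cong:
  fixes f g :: "'a::euclidean_space \<Rightarrow> 'b::topological_space"
  assumes "AE x in lborel. f x = g x" and "g \<in> borel_measurable lebesgue"
  shows "f \<in> borel_measurable lebesgue"
  using assms by (intro completion.measurable_AE_cong[where f = f and g = g] AE_completion) auto

text \<open>Bridge from \<open>lebesgue\<close>, the completion of \<open>lborel\<close>, back to
  \<open>lborel\<close>: product measure results apply to the Borel representative \<open>g\<close>
  and are carried over to \<open>f\<close>.\<close>

lemma integral_lebesgue_AE_lborel: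
  fixes f g :: "'a::euclidean_space \<Rightarrow> real"
  assumes "AE x in lborel. f x = g x" and "g \<in> borel_measurable lborel"
  shows "integrable lebesgue f \<longleftrightarrow> integrable lborel g"
    and "integral\<^sup>L lebesgue f = integral\<^sup>L lborel g"
proof -
  have g: "g \<in> borel_measurable lebesgue"
    using assms(2) by (simp add: measurable_completion)
  have f: "f \<in> borel_measurable lebesgue"
    using assms(1) g by (rule borel_measurable_lebesgue_AE_cong)
  have ae: "AE x in lebesgue. f x = g x"
    using assms(1) by (rule AE_completion)
  show "integrable lebesgue f \<longleftrightarrow> integrable lborel g"
    using integrable_cong_AE[OF f g ae] integrable_completion[OF assms(2)] by simp
  show "integral\<^sup>L lebesgue f = integral\<^sup>L lborel g"
    using integral_cong_AE[OF f g ae] integral_completion[OF assms(2)] by simp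
qed

lemma integrable_lebesgue_obtain_borel:
  fixes f :: "'a::euclidean_space \<Rightarrow> real"
  assumes "integrable lebesgue f"
  obtains g where "g \<in> borel_measurable lborel" "integrable lborel g" "AE x in lborel. f x = g x"
  using assms completion_ex_borel_measurable_real[OF borel_measurable_integrable[OF assms]]
    integral_lebesgue_AE_lborel(1) by blast

text \<open>\<open>lebesgue\<close> on a product space is the completion of
  \<open>lborel \<Otimes>\<^sub>M lborel\<close>, not the product of the two completions, so Fubini
  is applied to a Borel representative.\<close>

lemma lebesgue_Fubini:
  fixes f :: "'a::euclidean_space \<times> 'b::euclidean_space \<Rightarrow> real"
  assumes "integrable lebesgue f"
  shows "integrable lebesgue (\<lambda>x. \<integral>y. f (x, y) \<partial>lebesgue)"
    and "(\<integral>x. (\<integral>y. f (x, y) \<partial>lebesgue) \<partial>lebesgue) = integral\<^sup>L lebesgue f"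
proof -
  obtain g where g: "g \<in> borel_measurable lborel" "integrable lborel g"
      and fg: "AE z in lborel. f z = g z"
    using assms by (rule integrable_lebesgue_obtain_borel)
  have [measurable]: "g \<in> borel_measurable (lborel \<Otimes>\<^sub>M lborel)"
    using g(1) by (simp add: lborel_prod)
  have int: "integrable (lborel \<Otimes>\<^sub>M lborel) g"
    using g(2) by (simp add: lborel_prod)
  have "AE x in lborel. AE y in lborel. f (x, y) = g (x, y)"
    using fg[folded lborel_prod] by (rule lborel_pair.AE_pair)
  \<comment> \<open>A section of \<open>f\<close> is known to agree a.e. with that of
    \<open>g\<close> only for almost every \<open>x\<close>; the exceptional \<open>x\<close> form a
    null set, which the bridge lemma absorbs when it is used again for the outer integral.\<close>
  then have ae: "AE x in lborel. (\<integral>y. f (x, y) \<partial>lebesgue) = (\<integral>y. g (x, y) \<partial>lborel)"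
    by eventually_elim (rule integral_lebesgue_AE_lborel, auto)
  have I: "integrable lborel (\<lambda>x. \<integral>y. g (x, y) \<partial>lborel)"
    using int by (rule lborel_pair.integrable_fst')
  note * = integral_lebesgue_AE_lborel[OF ae borel_measurable_integrable[OF I]]
  show "integrable lebesgue (\<lambda>x. \<integral>y. f (x, y) \<partial>lebesgue)"
    using * I by simp
  show "(\<integral>x. (\<integral>y. f (x, y) \<partial>lebesgue) \<partial>lebesgue) = integral\<^sup>L lebesgue f"
    using *(2) lborel_pair.integral_fst'[OF int] integral_lebesgue_AE_lborel(2)[OF fg g(1)]
    by (simp add: lborel_prod)
qed

lemma lebesgue_integral_swap:
  fixes f :: "'a::euclidean_space \<times> 'b::euclidean_space \<Rightarrow> real"
  assumes "integrable lebesgue f"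
  shows "integrable lebesgue (\<lambda>(x, y). f (y, x))"
    and "(\<integral>(x, y). f (y, x) \<partial>lebesgue) = integral\<^sup>L lebesgue f"
proof -
  obtain g where g: "g \<in> borel_measurable lborel" "integrable lborel g"
      and fg: "AE z in lborel. f z = g z"
    using assms by (rule integrable_lebesgue_obtain_borel)
  have g': "g \<in> borel_measurable (lborel \<Otimes>\<^sub>M lborel)" "integrable (lborel \<Otimes>\<^sub>M lborel) g"
    using g by (simp_all add: lborel_prod)
  \<comment> \<open>The product measure is its own image under the coordinate exchange, so the a.e.
    equality of \<open>f\<close> and \<open>g\<close> can be pulled back along it.\<close>
  have "AE z in distr (lborel \<Otimes>\<^sub>M lborel) (lborel \<Otimes>\<^sub>M lborel) (\<lambda>(x, y). (y, x)). f z = g z"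
    using fg[folded lborel_prod] lborel_pair.distr_pair_swap by metis
  then have "AE z in lborel \<Otimes>\<^sub>M lborel. f (case z of (x, y) \<Rightarrow> (y, x)) = g (case z of (x, y) \<Rightarrow> (y, x))"
    by (rule AE_distrD[rotated]) simp
  then have ae: "AE z in lborel. (\<lambda>(x, y). f (y, x)) z = (\<lambda>(x, y). g (y, x)) z"
    unfolding lborel_prod by (rule eventually_mono) auto
  have i: "integrable (lborel \<Otimes>\<^sub>M lborel) (\<lambda>(x, y). g (y, x))"
    using g'(2) by (rule lborel_pair.integrable_product_swap)
  note * = integral_lebesgue_AE_lborel[OF ae borel_measurable_integrable[OF i[unfolded lborel_prod]]]
  show "integrable lebesgue (\<lambda>(x, y). f (y, x))"
    using * i by (simp add: lborel_prod)
  show "(\<integral>(x, y). f (y, x) \<partial>lebesgue) = integral\<^sup>L lebesgue f"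
    using *(2) lborel_pair.integral_product_swap[OF g'(1)] integral_lebesgue_AE_lborel(2)[OF fg g(1)]
    by (simp add: lborel_prod)
qed

section \<open>Symmetry and positivity of the nonlocal operator\<close>

text \<open>One integral over the product rather than an iterated one, so that \<open>x\<close> and
  \<open>y\<close> can be exchanged in a single step.\<close>

definition nonlocal_form ::
  "(real ^ 'd) set \<Rightarrow> (real ^ 'd \<Rightarrow> real) \<Rightarrow> (real ^ 'd \<Rightarrow> real) \<Rightarrow> (real ^ 'd \<Rightarrow> real) \<Rightarrow> real" where
  "nonlocal_form \<Omega> J u v = (LINT (x, y):\<Omega> \<times> \<Omega>|lebesgue. J (x - y) * (u x - u y) * v x)"

text \<open>The factor \<open>v x\<close> is constant in the inner variable and leaves the inner
  integral; Fubini does the rest.\<close>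

lemma L2_ip_nonlocal_op:
  assumes "nonlocal_form_integrable \<Omega> J u v"
  shows "set_integrable lebesgue \<Omega> (\<lambda>x. nonlocal_op \<Omega> J u x * v x)"
    and "L2_ip \<Omega> (nonlocal_op \<Omega> J u) v = nonlocal_form \<Omega> J u v"
proof -
  let ?h = "\<lambda>z. indicat_real (\<Omega> \<times> \<Omega>) z *\<^sub>R (case z of (x, y) \<Rightarrow> J (x - y) * (u x - u y) * v x)"
  have h: "integrable lebesgue ?h"
    using assms by (simp add: nonlocal_form_integrable_def set_integrable_def)
  have "(\<integral>y. ?h (x, y) \<partial>lebesgue) = indicator \<Omega> x *\<^sub>R (nonlocal_op \<Omega> J u x * v x)" for x
  proof -
    have "(\<integral>y. ?h (x, y) \<partial>lebesgue)
        = (\<integral>y. (indicator \<Omega> x * v x) * (indicator \<Omega> y *\<^sub>R (J (x - y) * (u x - u y))) \<partial>lebesgue)"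
      by (simp add: indicator_times ac_simps)
    also have "\<dots> = (indicator \<Omega> x * v x) * nonlocal_op \<Omega> J u x"
      unfolding nonlocal_op_def set_lebesgue_integral_def by (rule integral_mult_right_zero)
    finally show ?thesis by (simp add: ac_simps)
  qed
  with lebesgue_Fubini[OF h]
  show "set_integrable lebesgue \<Omega> (\<lambda>x. nonlocal_op \<Omega> J u x * v x)"
    and "L2_ip \<Omega> (nonlocal_op \<Omega> J u) v = nonlocal_form \<Omega> J u v"
    by (simp_all add: set_integrable_def L2_ip_def nonlocal_form_def set_lebesgue_integral_def)
qed

lemma nonlocal_form_symmetrize:
  fixes J :: "real ^ 'd \<Rightarrow> real"
  assumes J_sym: "\<And>x y. J (x - y) = J (y - x)"
    and "nonlocal_form_integrable \<Omega> J u v"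
  shows "2 * nonlocal_form \<Omega> J u v
    = (LINT (x, y):\<Omega> \<times> \<Omega>|lebesgue. J (x - y) * ((u x - u y) * (v x - v y)))"
proof -
  let ?h = "\<lambda>z. indicat_real (\<Omega> \<times> \<Omega>) z *\<^sub>R (case z of (x, y) \<Rightarrow> J (x - y) * (u x - u y) * v x)"
  have h: "integrable lebesgue ?h"
    using assms by (simp add: nonlocal_form_integrable_def set_integrable_def)
  have "2 * nonlocal_form \<Omega> J u v = integral\<^sup>L lebesgue ?h + (\<integral>(x, y). ?h (y, x) \<partial>lebesgue)"
    using lebesgue_integral_swap(2)[OF h] by (simp add: nonlocal_form_def set_lebesgue_integral_def)
  also have "\<dots> = (\<integral>z. ?h z + (case z of (x, y) \<Rightarrow> ?h (y, x)) \<partial>lebesgue)"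
    using h lebesgue_integral_swap(1)[OF h] by (intro Bochner_Integration.integral_add[symmetric])
  also have "\<dots> = (LINT (x, y):\<Omega> \<times> \<Omega>|lebesgue. J (x - y) * ((u x - u y) * (v x - v y)))"
    unfolding set_lebesgue_integral_def
  proof (intro Bochner_Integration.integral_cong refl)
    fix z :: "(real ^ 'd) \<times> (real ^ 'd)"
    obtain x y where "z = (x, y)" by (cases z)
    then show "?h z + (case z of (x, y) \<Rightarrow> ?h (y, x)) = indicator (\<Omega> \<times> \<Omega>) z *\<^sub>R
        (case z of (x, y) \<Rightarrow> J (x - y) * ((u x - u y) * (v x - v y)))"
      \<comment> \<open>The exchange turns \<open>(u x - u y) * v x\<close> into
        \<open>- (u x - u y) * v y\<close> with the same kernel value, so the sum factors.\<close>
      using J_sym[of x y] by (simp add: indicator_times algebra_simps)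
  qed
  finally show ?thesis .
qed

lemma L2_ip_nonlocal_op_commute:
  assumes "\<And>x y. J (x - y) = J (y - x)"
    and "nonlocal_form_integrable \<Omega> J u v" "nonlocal_form_integrable \<Omega> J v u"
  shows "L2_ip \<Omega> (nonlocal_op \<Omega> J u) v = L2_ip \<Omega> (nonlocal_op \<Omega> J v) u"
  using nonlocal_form_symmetrize[of J, OF assms(1,2)] nonlocal_form_symmetrize[of J, OF assms(1,3)]
  by (simp add: L2_ip_nonlocal_op(2) assms(2,3) mult.commute)

text \<open>For \<open>v = u\<close> the symmetrized integrand is the kernel times a square.\<close>

lemma L2_ip_nonlocal_op_nonneg:
  assumes "\<And>x. J x \<ge> 0" and "\<And>x y. J (x - y) = J (y - x)"
    and "nonlocal_form_integrable \<Omega> J u u"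
  shows "L2_ip \<Omega> (nonlocal_op \<Omega> J u) u \<ge> 0"
proof -
  have "0 \<le> 2 * nonlocal_form \<Omega> J u u"
    unfolding nonlocal_form_symmetrize[of J, OF assms(2,3)] set_lebesgue_integral_def
    by (intro Bochner_Integration.integral_nonneg) (auto simp: assms(1))
  then show ?thesis
    by (simp add: L2_ip_nonlocal_op(2) assms(3))
qed

section \<open>Linear combinations\<close>

lemma nonlocal_op_sum:
  assumes "\<And>i. i \<in> I \<Longrightarrow> nonlocal_converges \<Omega> J (u i)" and "x \<in> \<Omega>"
  shows "nonlocal_op \<Omega> J (\<lambda>x. \<Sum>i\<in>I. c i * u i x) x = (\<Sum>i\<in>I. c i * nonlocal_op \<Omega> J (u i) x)"
proof -
  have "integrable lebesgue (\<lambda>y. c i * (indicator \<Omega> y *\<^sub>R (J (x - y) * (u i x - u i y))))"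
    if "i \<in> I" for i
    using assms(1)[OF that] \<open>x \<in> \<Omega>\<close>
    by (intro integrable_mult_right) (auto simp: nonlocal_converges_def set_integrable_def)
  then have "(\<integral>y. (\<Sum>i\<in>I. c i * (indicator \<Omega> y *\<^sub>R (J (x - y) * (u i x - u i y)))) \<partial>lebesgue)
    = (\<Sum>i\<in>I. c i * nonlocal_op \<Omega> J (u i) x)"
    by (simp add: Bochner_Integration.integral_sum nonlocal_op_def set_lebesgue_integral_def)
  also have "(\<lambda>y. \<Sum>i\<in>I. c i * (indicat_real \<Omega> y *\<^sub>R (J (x - y) * (u i x - u i y))))
    = (\<lambda>y. indicator \<Omega> y *\<^sub>R (J (x - y) * ((\<Sum>i\<in>I. c i * u i x) - (\<Sum>i\<in>I. c i * u i y))))"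
    by (simp add: sum_subtractf[symmetric] sum_distrib_left algebra_simps)
  finally show ?thesis
    by (simp add: nonlocal_op_def set_lebesgue_integral_def)
qed

lemma nonlocal_form_integrable_sum:
  assumes "\<And>i j. i \<in> I \<Longrightarrow> j \<in> I \<Longrightarrow> nonlocal_form_integrable \<Omega> J (u i) (u j)"
  shows "nonlocal_form_integrable \<Omega> J (\<lambda>x. \<Sum>i\<in>I. c i * u i x) (\<lambda>x. \<Sum>j\<in>I. d j * u j x)"
proof -
  have "integrable lebesgue (\<lambda>z. \<Sum>i\<in>I. \<Sum>j\<in>I. c i * d j *
      (indicator (\<Omega> \<times> \<Omega>) z *\<^sub>R (case z of (x, y) \<Rightarrow> J (x - y) * (u i x - u i y) * u j x)))"
    using assms by (intro Bochner_Integration.integrable_sum integrable_mult_right)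
      (auto simp: nonlocal_form_integrable_def set_integrable_def)
  also have "(\<lambda>z. \<Sum>i\<in>I. \<Sum>j\<in>I. c i * d j *
      (indicat_real (\<Omega> \<times> \<Omega>) z *\<^sub>R (case z of (x, y) \<Rightarrow> J (x - y) * (u i x - u i y) * u j x)))
    = (\<lambda>z. indicator (\<Omega> \<times> \<Omega>) z *\<^sub>R (case z of (x, y) \<Rightarrow>
        J (x - y) * ((\<Sum>i\<in>I. c i * u i x) - (\<Sum>i\<in>I. c i * u i y)) * (\<Sum>j\<in>I. d j * u j x)))"
    by (auto simp: fun_eq_iff sum_product sum_distrib_left sum_subtractf[symmetric]
        indicator_def algebra_simps intro!: sum.cong)
  finally show ?thesis
    by (simp add: nonlocal_form_integrable_def set_integrable_def)
qed

text \<open>Bilinearity for finite families: every expansion in the three time levels becomes an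
  instance, and regularity is asked only of the individual levels.\<close>

lemma L2_ip_nonlocal_op_sum:
  assumes conv: "\<And>i. i \<in> I \<Longrightarrow> nonlocal_converges \<Omega> J (u i)"
    and form: "\<And>i j. i \<in> I \<Longrightarrow> j \<in> I \<Longrightarrow> nonlocal_form_integrable \<Omega> J (u i) (u j)"
  shows "L2_ip \<Omega> (nonlocal_op \<Omega> J (\<lambda>x. \<Sum>i\<in>I. c i * u i x)) (\<lambda>x. \<Sum>j\<in>I. d j * u j x)
    = (\<Sum>i\<in>I. \<Sum>j\<in>I. c i * d j * L2_ip \<Omega> (nonlocal_op \<Omega> J (u i)) (u j))"
proof -
  have int: "integrable lebesgue (\<lambda>x. indicator \<Omega> x *\<^sub>R (nonlocal_op \<Omega> J (u i) x * u j x))"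
    if "i \<in> I" "j \<in> I" for i j
    using L2_ip_nonlocal_op(1)[OF form[OF that]] by (simp add: set_integrable_def)
  have "L2_ip \<Omega> (nonlocal_op \<Omega> J (\<lambda>x. \<Sum>i\<in>I. c i * u i x)) (\<lambda>x. \<Sum>j\<in>I. d j * u j x)
    = (\<integral>x. (\<Sum>i\<in>I. \<Sum>j\<in>I. c i * d j *
        (indicator \<Omega> x *\<^sub>R (nonlocal_op \<Omega> J (u i) x * u j x))) \<partial>lebesgue)"
    unfolding L2_ip_def set_lebesgue_integral_def
  proof (intro Bochner_Integration.integral_cong refl)
    fix x
    show "indicat_real \<Omega> x *\<^sub>R (nonlocal_op \<Omega> J (\<lambda>x. \<Sum>i\<in>I. c i * u i x) x * (\<Sum>j\<in>I. d j * u j x))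
      = (\<Sum>i\<in>I. \<Sum>j\<in>I. c i * d j * (indicator \<Omega> x *\<^sub>R (nonlocal_op \<Omega> J (u i) x * u j x)))"
    proof (cases "x \<in> \<Omega>")
      case True
      with conv have "nonlocal_op \<Omega> J (\<lambda>x. \<Sum>i\<in>I. c i * u i x) x
          = (\<Sum>i\<in>I. c i * nonlocal_op \<Omega> J (u i) x)"
        by (rule nonlocal_op_sum)
      then show ?thesis
        by (simp add: sum_product True) (simp add: mult_ac)
    qed simp
  qed
  also have "\<dots> = (\<Sum>i\<in>I. \<Sum>j\<in>I. c i * d j * L2_ip \<Omega> (nonlocal_op \<Omega> J (u i)) (u j))"
    using int by (simp add: Bochner_Integration.integral_sum L2_ip_def set_lebesgue_integral_def
        integrable_mult_right)
  finally show ?thesis .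
qed

section \<open>The energy estimate\<close>

theorem theorem3p2:
  fixes \<Omega> :: "(real ^ 'd) set"
    and J :: "real ^ 'd \<Rightarrow> real"
    and F F' :: "real \<Rightarrow> real"
    and M \<epsilon> C0 \<Delta>t :: real
    and n :: nat
    and \<phi> \<mu> :: "nat \<Rightarrow> real ^ 'd \<Rightarrow> real"
    and \<phi>t :: "real ^ 'd \<Rightarrow> real"
    and r :: "nat \<Rightarrow> real"
  assumes dom: "bounded_domain \<Omega>"
    and M_pos: "M > 0" and eps_pos: "\<epsilon> > 0"
    and F_deriv: "\<And>s. (F has_real_derivative F' s) (at s)"
    and F'_cont: "continuous_on UNIV F'"
    and J_nonneg: "\<And>x. J x \<ge> 0"
    and J_sym: "\<And>x y. J (x - y) = J (y - x)"
    and J_per: "domain_periodic \<Omega> J"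
    and E1_bdd_below: "\<And>u. u \<in> borel_measurable (lebesgue_on \<Omega>) \<Longrightarrow>
          set_integrable lebesgue \<Omega> (\<lambda>x. F (u x)) \<Longrightarrow> E1 \<Omega> F u \<ge> - C0"
    and E1_pos: "E1 \<Omega> F \<phi>t + C0 > 0"
    and dt_pos: "\<Delta>t > 0" and n_ge: "n \<ge> 1"
    \<comment> \<open>regularity: the integrals converge and may be exchanged\<close>
    and L_conv_phi: "\<And>k. k \<in> {n - 1, n, n + 1} \<Longrightarrow> nonlocal_converges \<Omega> J (\<phi> k)"
    and L_conv_mu: "nonlocal_converges \<Omega> J (\<mu> (n + 1))"
    and form_phi: "\<And>k l. k \<in> {n - 1, n, n + 1} \<Longrightarrow> l \<in> {n - 1, n, n + 1} \<Longrightarrow>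
          nonlocal_form_integrable \<Omega> J (\<phi> k) (\<phi> l)"
    and form_mu: "nonlocal_form_integrable \<Omega> J (\<mu> (n + 1)) (\<mu> (n + 1))"
    and F_int: "set_integrable lebesgue \<Omega> (\<lambda>x. F (\<phi>t x))"
    and F'_int: "set_integrable lebesgue \<Omega>
          (\<lambda>x. F' (\<phi>t x) * (3 * \<phi> (n + 1) x - 4 * \<phi> n x + \<phi> (n - 1) x))"
    \<comment> \<open>the SAV/BDF scheme\<close>
    and scheme_phi: "\<And>x. x \<in> \<Omega> \<Longrightarrow>
          (3 * \<phi> (n + 1) x - 4 * \<phi> n x + \<phi> (n - 1) x) / (2 * \<Delta>t)
            = - M * nonlocal_op \<Omega> J (\<mu> (n + 1)) x"
    and scheme_mu: "\<And>x. x \<in> \<Omega> \<Longrightarrow>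
          \<mu> (n + 1) x = \<epsilon>\<^sup>2 * nonlocal_op \<Omega> J (\<phi> (n + 1)) x
            + r (n + 1) / sqrt (E1 \<Omega> F \<phi>t + C0) * F' (\<phi>t x)"
    and scheme_r: "(3 * r (n + 1) - 4 * r n + r (n - 1)) / (2 * \<Delta>t)
          = (LINT x:\<Omega>|lebesgue. F' (\<phi>t x) / (2 * sqrt (E1 \<Omega> F \<phi>t + C0))
               * ((3 * \<phi> (n + 1) x - 4 * \<phi> n x + \<phi> (n - 1) x) / (2 * \<Delta>t)))"
  shows "\<epsilon>\<^sup>2 / 2 * L2_ip \<Omega> (nonlocal_op \<Omega> J (\<phi> (n + 1))) (\<phi> (n + 1))
       + \<epsilon>\<^sup>2 / 2 * L2_ip \<Omega> (nonlocal_op \<Omega> J (\<lambda>x. 2 * \<phi> (n + 1) x - \<phi> n x))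
                        (\<lambda>x. 2 * \<phi> (n + 1) x - \<phi> n x)
       + \<bar>r (n + 1)\<bar>\<^sup>2 + \<bar>2 * r (n + 1) - r n\<bar>\<^sup>2
     \<le> \<epsilon>\<^sup>2 / 2 * L2_ip \<Omega> (nonlocal_op \<Omega> J (\<phi> n)) (\<phi> n)
       + \<epsilon>\<^sup>2 / 2 * L2_ip \<Omega> (nonlocal_op \<Omega> J (\<lambda>x. 2 * \<phi> n x - \<phi> (n - 1) x))
                        (\<lambda>x. 2 * \<phi> n x - \<phi> (n - 1) x)
       + \<bar>r n\<bar>\<^sup>2 + \<bar>2 * r n - r (n - 1)\<bar>\<^sup>2"
proof -
  define a b c where abc: "a = \<phi> (n + 1)" "b = \<phi> n" "c = \<phi> (n - 1)"
  define s where "s = sqrt (E1 \<Omega> F \<phi>t + C0)"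
  \<comment> \<open>\<open>w\<close> is \<open>2 * \<Delta>t\<close> times the BDF2 difference
    quotient.\<close>
  define w where "w x = 3 * a x - 4 * b x + c x" for x
  let ?L = "nonlocal_op \<Omega> J"
  let ?A = "\<lambda>u v. L2_ip \<Omega> (?L u) v"
  let ?I = "{n - 1, n, n + 1}"
  \<comment> \<open>Coefficients \<open>p\<close>, \<open>q\<close>, \<open>t\<close> of the levels
    \<open>n + 1\<close>, \<open>n\<close>, \<open>n - 1\<close> as a function of the index, to fit
    the lemmas on finite sums.\<close>
  let ?k = "\<lambda>p q t i. if i = n + 1 then p else if i = n then q else t"
  have s_pos: "s > 0" using E1_pos by (simp add: s_def)
  have \<Omega>: "\<Omega> \<in> sets lebesgue"
    using dom by (auto simp: bounded_domain_def)
  \<comment> \<open>Subtraction on naturals truncates: \<open>n \<ge> 1\<close> is what keeps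
    \<open>n - 1\<close> apart from \<open>n\<close>.\<close>
  have distinct_idx: "n - 1 \<noteq> n" "n - 1 \<noteq> n + 1" "n \<noteq> n + 1"
    using n_ge by auto
  have sum_I: "(\<Sum>i\<in>?I. f i) = f (n - 1) + f n + f (n + 1)" for f :: "nat \<Rightarrow> real"
    using n_ge by (cases n) auto
  have k_sum: "(\<lambda>x. \<Sum>i\<in>?I. ?k p q t i * \<phi> i x) = (\<lambda>x. p * a x + q * b x + t * c x)"
    for p q t :: real
    unfolding sum_I abc by (simp only: distinct_idx if_True if_False refl) (simp add: algebra_simps)
  have form: "nonlocal_form_integrable \<Omega> J (\<lambda>x. p * a x + q * b x + t * c x)
      (\<lambda>x. p' * a x + q' * b x + t' * c x)" for p q t p' q' t' :: real
    using nonlocal_form_integrable_sum[where I = ?I and u = \<phi>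
        and c = "?k p q t" and d = "?k p' q' t'", OF form_phi]
    by (simp only: k_sum)
  \<comment> \<open>Symmetry reduces the nine entries of the Gram matrix of \<open>a\<close>,
    \<open>b\<close>, \<open>c\<close> to six, so that the rest is arithmetic in six reals.\<close>
  have comb: "?A (\<lambda>x. p * a x + q * b x + t * c x) (\<lambda>x. p' * a x + q' * b x + t' * c x)
     = p * p' * ?A a a + q * q' * ?A b b + t * t' * ?A c c
       + (p * q' + q * p') * ?A a b + (p * t' + t * p') * ?A a c + (q * t' + t * q') * ?A b c"
    for p q t p' q' t' :: real
  proof -
    have comm: "?A b a = ?A a b" "?A c a = ?A a c" "?A c b = ?A b c"
      by (simp_all add: abc L2_ip_nonlocal_op_commute[of J, OF J_sym] form_phi)
    show ?thesis
      using L2_ip_nonlocal_op_sum[where I = ?I and u = \<phi>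
          and c = "?k p q t" and d = "?k p' q' t'", OF L_conv_phi form_phi]
      unfolding k_sum sum_I
      by (simp only: distinct_idx if_True if_False refl abc[symmetric] comm) (simp add: algebra_simps)
  qed
  have extrap: "?A (\<lambda>x. 2 * a x - b x) (\<lambda>x. 2 * a x - b x) = 4 * ?A a a - 4 * ?A a b + ?A b b"
    "?A (\<lambda>x. 2 * b x - c x) (\<lambda>x. 2 * b x - c x) = 4 * ?A b b - 4 * ?A b c + ?A c c"
    using comb[of 2 "-1" 0 2 "-1" 0] comb[of 0 2 "-1" 0 2 "-1"] by simp_all
  have a_w: "?A a w = 3 * ?A a a - 4 * ?A a b + ?A a c"
    using comb[of 1 0 0 3 "-4" 1] by (simp add: w_def[abs_def])
  \<comment> \<open>The second difference \<open>a - 2 b + c\<close> is the square left over in the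
    BDF2 identity, that is, the numerical dissipation.\<close>
  have "0 \<le> ?A (\<lambda>x. a x - 2 * b x + c x) (\<lambda>x. a x - 2 * b x + c x)"
    using form[of 1 "-2" 1 1 "-2" 1] by (intro L2_ip_nonlocal_op_nonneg J_nonneg J_sym) simp
  then have second_diff: "0 \<le> ?A a a + 4 * ?A b b + ?A c c - 4 * ?A a b + 2 * ?A a c - 4 * ?A b c"
    using comb[of 1 "-2" 1 1 "-2" 1] by simp
  \<comment> \<open>This and \<open>F'_w_int\<close> below allow the integral of
    \<open>?L \<mu> * \<mu>\<close> to be split into two.\<close>
  have a_w_int: "set_integrable lebesgue \<Omega> (\<lambda>x. ?L a x * w x)"
    using L2_ip_nonlocal_op(1)[OF form[of 1 0 0 3 "-4" 1]] by (simp add: w_def)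
  define G where "G = (LINT x:\<Omega>|lebesgue. F' (\<phi>t x) * w x)"
  have F'_w_int: "set_integrable lebesgue \<Omega> (\<lambda>x. F' (\<phi>t x) * w x)"
    using F'_int by (simp add: w_def abc)
  \<comment> \<open>The constant \<open>1 / (4 * s * \<Delta>t)\<close> collects
    \<open>1 / (2 * s)\<close> from the equation for \<open>r\<close> and
    \<open>1 / (2 * \<Delta>t)\<close> from the difference quotient.\<close>
  have "(3 * r (n + 1) - 4 * r n + r (n - 1)) / (2 * \<Delta>t)
      = (LINT x:\<Omega>|lebesgue. 1 / (4 * s * \<Delta>t) * (F' (\<phi>t x) * w x))"
    unfolding scheme_r s_def[symmetric] w_def abc by (simp add: mult_ac)
  also have "\<dots> = 1 / (4 * s * \<Delta>t) * G"
    unfolding G_def by (rule set_integral_mult_right)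
  finally have "4 * s * \<Delta>t * ((3 * r (n + 1) - 4 * r n + r (n - 1)) / (2 * \<Delta>t)) = G"
    using s_pos dt_pos by simp
  then have G: "G = 2 * s * (3 * r (n + 1) - 4 * r n + r (n - 1))"
    using dt_pos by simp
  \<comment> \<open>The first factor is replaced by means of the first scheme equation, the second
    by means of the equation for \<open>\<mu>\<close>.\<close>
  have "?L (\<mu> (n + 1)) x * \<mu> (n + 1) x
      = - (1 / (2 * \<Delta>t * M)) * (\<epsilon>\<^sup>2 * (?L a x * w x) + r (n + 1) / s * (F' (\<phi>t x) * w x))"
    if "x \<in> \<Omega>" for x
  proof -
    have "?L (\<mu> (n + 1)) x = - (1 / (2 * \<Delta>t * M)) * w x"
      using scheme_phi[OF that] M_pos dt_pos by (simp add: w_def abc field_simps)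
    then show ?thesis
      unfolding scheme_mu[OF that] abc s_def by (simp add: algebra_simps)
  qed
  then have "?A (\<mu> (n + 1)) (\<mu> (n + 1)) = (LINT x:\<Omega>|lebesgue.
      - (1 / (2 * \<Delta>t * M)) * (\<epsilon>\<^sup>2 * (?L a x * w x) + r (n + 1) / s * (F' (\<phi>t x) * w x)))"
    unfolding L2_ip_def using \<Omega> by (intro set_lebesgue_integral_cong) auto
  also have "\<dots> = - (1 / (2 * \<Delta>t * M)) * (\<epsilon>\<^sup>2 * ?A a w + r (n + 1) / s * G)"
    unfolding set_integral_mult_right
    by (subst set_integral_add) (use a_w_int F'_w_int in \<open>auto simp: G_def L2_ip_def\<close>)
  finally have "- (1 / (2 * \<Delta>t * M)) * (\<epsilon>\<^sup>2 * ?A a w + r (n + 1) / s * G) \<ge> 0"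
    using L2_ip_nonlocal_op_nonneg[of J, OF J_nonneg J_sym form_mu] by simp
  \<comment> \<open>Only the signs of \<open>M\<close> and \<open>\<Delta>t\<close> enter here, so
    the size of the time step is not restricted.\<close>
  then have "\<epsilon>\<^sup>2 * ?A a w + r (n + 1) / s * G \<le> 0"
    using M_pos dt_pos by (simp add: zero_le_mult_iff mult_le_0_iff divide_le_0_iff)
  \<comment> \<open>The nonlinear term becomes purely a term in \<open>r\<close>: the factor
    \<open>s\<close> in \<open>G\<close> cancels against \<open>r (n + 1) / s\<close>.\<close>
  then have "\<epsilon>\<^sup>2 * ?A a w + 2 * r (n + 1) * (3 * r (n + 1) - 4 * r n + r (n - 1)) \<le> 0"
    using s_pos by (simp add: G algebra_simps)
  \<comment> \<open>BDF2 identity: \<open>2 (a, 3 a - 4 b + c) = |a|\<^sup>2 + |2 a - b|\<^sup>2 - |b|\<^sup>2 - |2 b - c|\<^sup>2 + |a - 2 b + c|\<^sup>2\<close> for both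
    quadratic forms\<close>
  moreover have "0 \<le> (r (n + 1) - 2 * r n + r (n - 1))\<^sup>2"
    by simp
  \<comment> \<open>The weight is \<open>\<epsilon>\<^sup>2 / 2\<close> because
    \<open>\<epsilon>\<^sup>2 * ?A a w\<close> lacks the factor 2 of the BDF2 identity, which the
    term in \<open>r\<close> carries.\<close>
  moreover have "0 \<le> \<epsilon>\<^sup>2 / 2 * (?A a a + 4 * ?A b b + ?A c c - 4 * ?A a b + 2 * ?A a c - 4 * ?A b c)"
    using second_diff by simp
  ultimately show ?thesis
    unfolding abc[symmetric] extrap a_w power2_abs
    by (simp add: algebra_simps power2_eq_square)
qed

end
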